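(* Let $x$ be an indeterminate. For all positive integers $n$, $$\det_{0\le i,j\le n-1}\left(4^i\binom {x+i+2j+3}{2j+3}+\binom {x-i+2j+3}{2j+3}\right)=\left(2\cdot 6^{\binom n2}\prod _{i=0} ^{n-1}\frac {i!} {(2i+3)!}\right)\left((x+2)(x+3)\prod _{i=0} ^{n-1}(x+3i+1)_{n-i}\right)\cdot\mathrm{Pol}_n(x),$$ where $\mathrm{Pol}_n(x)$ is a monic polynomial in $x$ of degree $2n-2$.
   Context: The binomial coefficient is $\binom{\alpha}{p}=\frac{\alpha(\alpha-1)\cdots(\alpha-p+1)}{p!}$ if $p\ge 0$ is an integer, and $0$ if $p<0$. The Pochhammer symbol is $(\alpha)_p=\alpha(\alpha+1)\cdots(\alpha+p-1)$ for $p\ge1$ and $(\alpha)_0=1$. The assertion is that for each $n$ such a polynomial $\mathrm{Pol}_n(x)$ (with rational coefficients) exists. *)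

theory Defs
  imports
    "HOL-Computational_Algebra.Polynomial"
    "Jordan_Normal_Form.Determinant"
begin

abbreviation indet :: "rat poly" where
  "indet \<equiv> [:0, 1:]"

text \<open>
  The library's \<open>gchoose\<close> is constrained to fields, so the binomial coefficient whose upper entry
  is a polynomial is defined here by the same product. The lemma relates the two.
\<close>

definition poly_binomial :: "rat poly \<Rightarrow> nat \<Rightarrow> rat poly" where
  "poly_binomial a p = smult (1 / fact p) (\<Prod>k<p. a - of_nat k)"

lemma poly_poly_binomial: "poly (poly_binomial a p) x = poly a x gchoose p"
  by (simp add: poly_binomial_def gbinomial_prod_rev poly_prod atLeast0LessThan)

end

theory Submission
  imports
    Defs
    "Jordan_Normal_Form.Char_Poly"
    "HOL-Computational_Algebra.Formal_Power_Series"
    "HOL-Computational_Algebra.Polynomial_Factorial"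
    "HOL-Computational_Algebra.Field_as_Ring"
begin

text \<open>
  The \<open>(i, j)\<close> entry is the coefficient of \<open>z^(2j+3)\<close> in \<open>(1-z)^(-x-1) (u^i + v^i)\<close> with
  \<open>u = 4/(1-z)\<close> and \<open>v = 1-z\<close>. As \<open>u v = 4\<close>, the sum \<open>u^i + v^i\<close> is a polynomial of degree \<open>i\<close> in
  \<open>s = u + v\<close>, monic for \<open>i > 0\<close> and equal to 2 for \<open>i = 0\<close>; so, up to the factor 2, row operations
  allow it to be replaced by any monic polynomial of degree \<open>i\<close> in \<open>s\<close>.

  The choice \<open>(s-5)^i\<close>, where \<open>s - 5 = z(3+z)/(1-z)\<close>, lowers the degrees of the entries
  and yields degree and leading coefficient of the determinant.

  At \<open>x = -K-1\<close> the prefactor is \<open>(1-z)^K\<close>, and with \<open>s - 4 = (1+z)^2/(1-z)\<close> and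
  \<open>s - 2 = (3+z^2)/(1-z)\<close> one has \<open>(1-z)^K (s-4)^b (s-2)^(K-3b) = (1-z^2)^(2b) (3+z^2)^(K-3b)\<close>.
  This is even in \<open>z\<close>, so the row of degree \<open>K-2b\<close> vanishes. Counting the admissible \<open>b\<close> gives
  the multiplicity of the root \<open>-K-1\<close> in the product of Pochhammer symbols. For \<open>K = 1, 2\<close> the
  row of degree 0 vanishes as well, because \<open>(1-z)^K\<close> has no odd coefficients beyond that of \<open>z\<close>;
  this explains the factors \<open>x+2\<close> and \<open>x+3\<close>.
\<close>

section \<open>Top coefficients of products under degree bounds\<close>

lemma coeff_mult_degree_le:
  fixes p q :: "'a::comm_semiring_1 poly"
  assumes "degree p \<le> m" "degree q \<le> n"
  shows "coeff (p * q) (m + n) = coeff p m * coeff q n"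
proof -
  have "coeff p i * coeff q (m + n - i) = 0" if "i \<noteq> m" for i
    using assms that by (cases "i < m") (auto simp: coeff_eq_0)
  then show ?thesis
    by (subst coeff_mult, subst sum.remove[of _ m]) (auto intro!: sum.neutral)
qed

lemma degree_prod_bound:
  fixes p :: "'i \<Rightarrow> 'a::comm_semiring_1 poly"
  assumes "finite I" "\<And>i. i \<in> I \<Longrightarrow> degree (p i) \<le> w i"
  shows "degree (prod p I) \<le> sum w I"
  using assms
  by (induction I rule: finite_induct) (auto intro: order.trans[OF degree_mult_le] add_mono)

lemma coeff_prod_bound:
  fixes p :: "'i \<Rightarrow> 'a::comm_semiring_1 poly"
  assumes "finite I" "\<And>i. i \<in> I \<Longrightarrow> degree (p i) \<le> w i"
  shows "coeff (prod p I) (sum w I) = (\<Prod>i\<in>I. coeff (p i) (w i))"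
  using assms
  by (induction I rule: finite_induct)
     (auto simp: coeff_mult_degree_le degree_prod_bound)

section \<open>Polynomials evaluated at formal power series\<close>

interpretation fps_const_hom: comm_ring_hom "fps_const :: 'a::comm_ring_1 \<Rightarrow> 'a fps"
  by unfold_locales (auto simp: fps_const_add[symmetric] fps_const_mult[symmetric] simp del: fps_const_add fps_const_mult)
interpretation fps_const_poly_hom: map_poly_comm_ring_hom "fps_const :: 'a::comm_ring_1 \<Rightarrow> 'a fps" ..

text \<open>Since \<open>q\<close> is a polynomial, \<open>s\<close> may have a nonzero constant
  term, as \<open>step_fps\<close> does below.\<close>

definition fps_eval :: "'a::comm_ring_1 poly \<Rightarrow> 'a fps \<Rightarrow> 'a fps"
  where "fps_eval q s = poly (map_poly fps_const q) s"

lemma fps_eval_mult: "fps_eval (p * q) s = fps_eval p s * fps_eval q s"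
  by (simp add: fps_eval_def hom_distribs)

lemma fps_eval_diff: "fps_eval (p - q) s = fps_eval p s - fps_eval q s"
  by (simp add: fps_eval_def hom_distribs)

lemma fps_eval_power: "fps_eval (p ^ m) s = fps_eval p s ^ m"
  by (simp add: fps_eval_def hom_distribs)

lemma fps_eval_pCons: "fps_eval (pCons c p) s = fps_const c + s * fps_eval p s"
  by (simp add: fps_eval_def fps_const_hom.map_poly_pCons_hom)

lemma fps_eval_0: "fps_eval 0 s = 0"
  by (simp add: fps_eval_def)

text \<open>The range of summation depends on \<open>n\<close> only, so that a family of such
  \<open>q\<close> acts by an \<open>n\<close> by \<open>n\<close> coefficient matrix.\<close>

lemma fps_nth_mult_eval:
  assumes "degree q < n"
  shows "fps_nth (E * fps_eval q s) m = (\<Sum>e<n. coeff q e * fps_nth (E * s ^ e) m)"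
proof -
  have "degree (map_poly fps_const q) = degree q"
    by (rule degree_map_poly) simp
  then have "fps_eval q s = (\<Sum>e\<le>degree q. fps_const (coeff q e) * s ^ e)"
    by (simp add: fps_eval_def poly_altdef coeff_map_poly)
  also have "\<dots> = (\<Sum>e<n. fps_const (coeff q e) * s ^ e)"
    using assms by (intro sum.mono_neutral_left) (auto simp: coeff_eq_0)
  finally have "fps_eval q s = \<dots>" .
  then show ?thesis
    by (simp add: sum_distrib_left fps_sum_nth mult.left_commute[of E])
qed

section \<open>The binomial series in powers of z\<close>

abbreviation fps_geom :: "'a::comm_ring_1 fps" where "fps_geom \<equiv> Abs_fps (\<lambda>_. 1)"

lemma fps_geom_mult: "(1 - fps_X) * (fps_geom :: 'a::comm_ring_1 fps) = 1"
  by (rule fps_ext) (simp add: left_diff_distrib)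

text \<open>The expansion of \<open>(1-z)^(-a-1)\<close>.\<close>

definition binom_fps :: "rat poly \<Rightarrow> rat poly fps"
  where "binom_fps a = Abs_fps (\<lambda>m. poly_binomial (a + of_nat m) m)"

lemma binom_fps_nth: "fps_nth (binom_fps a) m = poly_binomial (a + of_nat m) m"
  by (simp add: binom_fps_def)

lemma poly_binomial_0: "poly_binomial a 0 = 1"
  by (simp add: poly_binomial_def)

lemma poly_binomial_Suc_Suc:
  "poly_binomial (a + 1) (Suc m) = poly_binomial a m + poly_binomial a (Suc m)"
  by (subst poly_eq_poly_eq_iff[symmetric], rule ext) (simp add: poly_poly_binomial gbinomial_Suc_Suc)

text \<open>This is Pascal's rule, read coefficient by coefficient.\<close>

lemma binom_fps_mult: "(1 - fps_X) * binom_fps a = binom_fps (a - 1)"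
proof (rule fps_ext)
  fix m show "fps_nth ((1 - fps_X) * binom_fps a) m = fps_nth (binom_fps (a - 1)) m"
    using poly_binomial_Suc_Suc[of "a + of_nat (m-1)" "m-1"]
    by (cases m) (auto simp: left_diff_distrib binom_fps_nth poly_binomial_0 algebra_simps)
qed

lemma binom_fps_mult_power: "(1 - fps_X) ^ i * binom_fps a = binom_fps (a - of_nat i)"
proof (induction i)
  case (Suc i)
  have "(1 - fps_X) ^ Suc i * binom_fps a = (1 - fps_X) * ((1 - fps_X) ^ i * binom_fps a)"
    by (simp only: power_Suc mult.assoc)
  also have "\<dots> = binom_fps (a - of_nat i - 1)"
    by (simp only: Suc binom_fps_mult)
  finally show ?case by (simp add: algebra_simps del: power_Suc)
qed simp

lemma binom_fps_mult_geom_power: "fps_geom ^ i * binom_fps a = binom_fps (a + of_nat i)"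
proof -
  have "fps_geom ^ i * binom_fps a = fps_geom ^ i * ((1 - fps_X) ^ i * binom_fps (a + of_nat i))"
    by (simp add: binom_fps_mult_power)
  also have "\<dots> = ((1 - fps_X) * fps_geom) ^ i * binom_fps (a + of_nat i)"
    by (simp only: power_mult_distrib mult_ac)
  finally show ?thesis by (simp only: fps_geom_mult power_one mult_1)
qed

lemma binom_fps_neg: "binom_fps (- of_nat (Suc K)) = (1 - fps_X) ^ K"
proof -
  \<comment> \<open>For \<open>m > 0\<close> the product in the coefficient contains the vanishing
    factor with \<open>k = m - 1\<close>.\<close>
  have "binom_fps (- 1) = 1"
  proof (rule fps_ext)
    fix m show "fps_nth (binom_fps (- 1)) m = fps_nth 1 m"
      by (cases m) (auto simp: binom_fps_nth poly_binomial_def prod_zero)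
  qed
  then show ?thesis
    using binom_fps_mult_power[of K "-1"] by simp
qed

text \<open>Dickson polynomials of the first kind with parameter 4.\<close>

fun dickson_poly :: "nat \<Rightarrow> 'a::comm_ring_1 poly" where
  "dickson_poly 0 = [:2:]"
| "dickson_poly (Suc 0) = [:0, 1:]"
| "dickson_poly (Suc (Suc i)) = [:0, 1:] * dickson_poly (Suc i) - [:4:] * dickson_poly i"

text \<open>The power sums p_i = u^i + v^i satisfy p_(i+2) = (u + v) p_(i+1) - u v p_i, which is the
  recurrence of \<open>dickson_poly\<close> when u v = 4.\<close>

lemma fps_eval_dickson_poly:
  assumes "u * v = 4"
  shows "fps_eval (dickson_poly i) (u + v) = u ^ i + v ^ i"
proof (induction i rule: dickson_poly.induct)
  case (3 i)
  have "fps_eval (dickson_poly (Suc (Suc i))) (u + v)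
    = (u + v) * (u ^ Suc i + v ^ Suc i) - (u * v) * (u ^ i + v ^ i)"
    unfolding assms dickson_poly.simps
    by (simp only: fps_eval_diff fps_eval_mult 3 fps_eval_pCons fps_eval_0) (simp add: numeral_fps_const)
  then show ?case by (simp add: algebra_simps)
qed (auto simp: fps_eval_pCons fps_eval_0 numeral_fps_const)

lemma degree_dickson_poly: "degree (dickson_poly i) \<le> i"
proof (induction i rule: dickson_poly.induct)
  case (3 i) then show ?case
    unfolding dickson_poly.simps
    by (intro degree_diff_le order.trans[OF degree_mult_le]) auto
qed (auto)

lemma coeff_dickson_poly: "coeff (dickson_poly i) i = (if i = 0 then 2 else 1)"
proof (induction i rule: dickson_poly.induct)
  case (3 i) then show ?case
    using degree_dickson_poly[where 'a='a, of i] by (simp add: coeff_eq_0)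
qed auto

section \<open>Determinants: change of basis, common factors, degree\<close>

text \<open>The matrix is the product of the lower triangular coefficient matrix of the
  \<open>q i\<close> and the matrix of the \<open>v i j\<close>.\<close>

lemma det_triangular_basis:
  fixes q :: "nat \<Rightarrow> 'a::comm_ring_1 poly" and v :: "nat \<Rightarrow> nat \<Rightarrow> 'a"
  assumes deg: "\<And>i. i < n \<Longrightarrow> degree (q i) \<le> i"
  shows "det (mat n n (\<lambda>(i, j). \<Sum>e<n. coeff (q i) e * v e j)) =
    (\<Prod>i<n. coeff (q i) i) * det (mat n n (\<lambda>(i, j). v i j))"
proof -
  define Q where "Q = mat n n (\<lambda>(i, e). coeff (q i) e)"
  define V where "V = mat n n (\<lambda>(i, j). v i j)"
  have "mat n n (\<lambda>(i, j). \<Sum>e<n. coeff (q i) e * v e j) = Q * V"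
    by (rule eq_matI) (auto simp: Q_def V_def scalar_prod_def lessThan_atLeast0)
  moreover have "det Q = (\<Prod>i<n. coeff (q i) i)"
    by (subst det_lower_triangular[of n])
       (auto simp: Q_def prod_list_diag_prod lessThan_atLeast0 intro!: coeff_eq_0 le_less_trans[OF deg])
  moreover have "det (Q * V) = det Q * det V"
    by (rule det_mult[of _ n]) (auto simp: Q_def V_def)
  ultimately show ?thesis
    by (simp add: V_def)
qed

text \<open>The polynomials \<open>monom (c i) i\<close> have a diagonal coefficient matrix, so this
  is a case of the change of basis.\<close>

lemma det_row_factors:
  fixes c :: "nat \<Rightarrow> 'a::comm_ring_1"
  shows "det (mat n n (\<lambda>(i, j). c i * v i j)) = (\<Prod>i<n. c i) * det (mat n n (\<lambda>(i, j). v i j))"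
proof -
  have "mat n n (\<lambda>(i, j). c i * v i j) = mat n n (\<lambda>(i, j). \<Sum>e<n. coeff (monom (c i) i) e * v e j)"
    by (rule eq_matI) (auto simp: if_distrib[of "\<lambda>x. x * _"] cong: if_cong)
  then show ?thesis
    using det_triangular_basis[of n "\<lambda>i. monom (c i) i" v] by (simp add: degree_monom_le)
qed

lemma power_card_dvd_det:
  fixes p :: "'a::idom_divide"
  assumes "S \<subseteq> {..<n}" "\<And>i j. i \<in> S \<Longrightarrow> j < n \<Longrightarrow> p dvd v i j"
  shows "p ^ card S dvd det (mat n n (\<lambda>(i, j). v i j))"
proof -
  define w where "w i j = (if i \<in> S then v i j div p else v i j)" for i j
  define c where "c i = (if i \<in> S then p else 1)" for i
  have "mat n n (\<lambda>(i, j). v i j) = mat n n (\<lambda>(i, j). c i * w i j)"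
    by (rule eq_matI) (auto simp: c_def w_def assms)
  moreover have "(\<Prod>i<n. c i) = p ^ card S"
    using assms(1) unfolding c_def
    by (subst prod.inter_restrict[symmetric]) (auto simp: Int_absorb1)
  ultimately show ?thesis by (simp add: det_row_factors)
qed

text \<open>In the Leibniz expansion every permutation meets each column once, so all products share
  the bound \<open>sum w {..<n}\<close>, and their coefficients there form the Leibniz expansion of
  the determinant of the coefficients.\<close>

lemma
  fixes v :: "nat \<Rightarrow> nat \<Rightarrow> 'a::comm_ring_1 poly"
  assumes "\<And>i j. i < n \<Longrightarrow> j < n \<Longrightarrow> degree (v i j) \<le> w j"
  shows degree_det_bound: "degree (det (mat n n (\<lambda>(i, j). v i j))) \<le> sum w {..<n}"
    and coeff_det_bound: "coeff (det (mat n n (\<lambda>(i, j). v i j))) (sum w {..<n}) =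
      det (mat n n (\<lambda>(i, j). coeff (v i j) (w j)))"
proof -
  let ?P = "{p. p permutes {0..<n}}"
  have expand: "det (mat n n (\<lambda>(i, j). u i j)) = (\<Sum>p\<in>?P. signof p * (\<Prod>i<n. u i (p i)))"
    for u :: "nat \<Rightarrow> nat \<Rightarrow> 'b::comm_ring_1"
    by (subst det_def'[of _ n])
       (auto simp: lessThan_atLeast0 permutes_in_image intro!: sum.cong prod.cong arg_cong2[of _ _ _ _ "(*)"])
  have in_range: "p i < n" if "p \<in> ?P" "i < n" for p i
    using that permutes_in_image[of p "{0..<n}" i] by auto
  have perm_sum: "(\<Sum>i<n. w (p i)) = sum w {..<n}" if "p \<in> ?P" for p
    using that sum.permute[of p "{0..<n}" w] by (simp add: lessThan_atLeast0)
  have signof: "degree (signof p * r) = degree r" "coeff (signof p * r) d = signof p * coeff r d"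
    for p :: "nat \<Rightarrow> nat" and r :: "'a poly" and d
    by (simp_all add: sign_def)
  have deg: "degree (\<Prod>i<n. v i (p i)) \<le> sum w {..<n}" if "p \<in> ?P" for p
    using that assms in_range perm_sum degree_prod_bound[of "{..<n}" "\<lambda>i. v i (p i)" "\<lambda>i. w (p i)"]
    by simp
  have co: "coeff (\<Prod>i<n. v i (p i)) (sum w {..<n}) = (\<Prod>i<n. coeff (v i (p i)) (w (p i)))"
    if "p \<in> ?P" for p
    using that assms in_range perm_sum coeff_prod_bound[of "{..<n}" "\<lambda>i. v i (p i)" "\<lambda>i. w (p i)"]
    by simp
  show "degree (det (mat n n (\<lambda>(i, j). v i j))) \<le> sum w {..<n}"
    unfolding expand by (intro degree_sum_le) (auto simp: signof deg finite_permutations)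
  show "coeff (det (mat n n (\<lambda>(i, j). v i j))) (sum w {..<n}) =
      det (mat n n (\<lambda>(i, j). coeff (v i j) (w j)))"
    unfolding expand coeff_sum signof by (intro sum.cong refl) (simp add: co)
qed

text \<open>The series \<open>s\<close> of the introduction.\<close>

definition step_fps :: "'a::comm_ring_1 fps" where "step_fps = 4 * fps_geom + (1 - fps_X)"

lemma step_fps_mult: "(1 - fps_X) * step_fps = (4 + (1 - fps_X)^2 :: 'a::comm_ring_1 fps)"
proof -
  have "(1 - fps_X) * step_fps = 4 * ((1 - fps_X) * fps_geom) + (1 - fps_X :: 'a fps)^2"
    by (simp add: step_fps_def algebra_simps power2_eq_square)
  then show ?thesis by (simp only: fps_geom_mult mult_1_right)
qed

text \<open>The constant term of \<open>step_fps\<close> is 5; without it a multiple of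
  \<open>fps_X\<close> is left, so the i-th power starts at z^i.\<close>

lemma step_fps_minus_5: "step_fps - 5 = fps_X * (3 + fps_X) * (fps_geom :: 'a::comm_ring_1 fps)"
proof -
  have "(1 - fps_X) * (step_fps - 5) = (fps_X * (3 + fps_X) :: 'a fps)"
    unfolding right_diff_distrib[of _ step_fps] step_fps_mult by (simp add: algebra_simps power2_eq_square)
  moreover have "(1 - fps_X) * fps_geom * (step_fps - 5) = (1 - fps_X) * (step_fps - 5) * (fps_geom :: 'a fps)"
    by (simp only: mult_ac)
  ultimately show ?thesis by (simp only: fps_geom_mult mult_1)
qed

lemma even_fps_mult:
  fixes f g :: "'a::comm_ring_1 fps"
  assumes "\<And>m. odd m \<Longrightarrow> fps_nth f m = 0" "\<And>m. odd m \<Longrightarrow> fps_nth g m = 0" "odd m"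
  shows "fps_nth (f * g) m = 0"
  unfolding fps_mult_nth
proof (rule sum.neutral, rule ballI)
  fix i assume "i \<in> {0..m}"
  then have "odd i \<or> odd (m - i)" using \<open>odd m\<close> by auto
  then show "fps_nth f i * fps_nth g (m - i) = 0" by (elim disjE) (simp_all add: assms(1,2))
qed

lemma even_fps_power:
  fixes f :: "'a::comm_ring_1 fps"
  assumes "\<And>m. odd m \<Longrightarrow> fps_nth f m = 0" "odd m"
  shows "fps_nth (f ^ k) m = 0"
  using assms(2)
proof (induction k arbitrary: m)
  case 0 then show ?case by (auto elim: oddE)
next
  case (Suc k) then show ?case using even_fps_mult[OF assms(1), of "f ^ k"] by simp
qed

text \<open>The power of \<open>1 - fps_X\<close> is shared out: three factors for each
  \<open>step_fps - 4\<close>, giving \<open>(1 - fps_X^2)^2\<close>, and one for each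
  \<open>step_fps - 2\<close>, giving \<open>3 + fps_X^2\<close>. Both results are even.\<close>

lemma even_kernel:
  assumes "odd m"
  shows "fps_nth ((1 - fps_X) ^ (3 * b + a) * ((step_fps - 4) ^ b * (step_fps - 2) ^ a)) m = (0 :: 'a::comm_ring_1)"
proof -
  have 1: "(1 - fps_X) * (step_fps - 4) = (1 + fps_X :: 'a fps)^2"
    unfolding right_diff_distrib[of _ step_fps] step_fps_mult by (simp add: algebra_simps power2_eq_square)
  have "(1 - fps_X) ^ 3 * (step_fps - 4) = (1 - fps_X)^2 * ((1 - fps_X) * (step_fps - 4 :: 'a fps))"
    by (simp add: power3_eq_cube power2_eq_square mult.assoc)
  also have "\<dots> = (1 - fps_X^2)^2"
    unfolding 1 by (simp add: power2_eq_square algebra_simps)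
  finally have 2: "(1 - fps_X) ^ 3 * (step_fps - 4) = (1 - fps_X^2 :: 'a fps)^2" .
  have 3: "(1 - fps_X) * (step_fps - 2) = (3 + fps_X^2 :: 'a fps)"
    unfolding right_diff_distrib[of _ step_fps] step_fps_mult by (simp add: algebra_simps power2_eq_square)
  have "(1 - fps_X) ^ (3 * b + a) * ((step_fps - 4) ^ b * (step_fps - 2) ^ a)
      = ((1 - fps_X) ^ 3 * (step_fps - 4)) ^ b * ((1 - fps_X) * (step_fps - 2 :: 'a fps)) ^ a"
    by (simp only: power_add power_mult power_mult_distrib) (simp only: mult_ac)
  also have "\<dots> = ((1 - fps_X^2)^2)^b * (3 + fps_X^2)^a"
    unfolding 2 3 ..
  also have "fps_nth \<dots> m = 0"
    using assms by (intro even_fps_mult even_fps_power)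
      (auto simp: fps_X_power_iff fps_numeral_nth odd_pos)
  finally show ?thesis .
qed

section \<open>Determinants of polynomials in the series s\<close>

text \<open>The outer variable of \<open>q\<close> stands for \<open>step_fps\<close>, the inner one
  for x.\<close>

definition step_coeff :: "nat \<Rightarrow> rat poly poly \<Rightarrow> rat poly"
  where "step_coeff j q = fps_nth (binom_fps indet * fps_eval q step_fps) (2 * j + 3)"

text \<open>The rows belong to the powers of \<open>step_fps\<close>; this is the reference value to
  which other choices of polynomials are reduced.\<close>

definition step_det :: "nat \<Rightarrow> rat poly"
  where "step_det n = det (mat n n (\<lambda>(i, j). fps_nth (binom_fps indet * step_fps ^ i) (2 * j + 3)))"

lemma det_step_coeff:
  assumes "\<And>i. i < n \<Longrightarrow> degree (q i) \<le> i"
  shows "det (mat n n (\<lambda>(i, j). step_coeff j (q i))) = (\<Prod>i<n. coeff (q i) i) * step_det n"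
proof -
  have "mat n n (\<lambda>(i, j). step_coeff j (q i)) = mat n n (\<lambda>(i, j).
      \<Sum>e<n. coeff (q i) e * fps_nth (binom_fps indet * step_fps ^ e) (2 * j + 3))"
    unfolding step_coeff_def
    by (rule cong_mat) (auto intro!: fps_nth_mult_eval le_less_trans[OF assms])
  then show ?thesis
    using det_triangular_basis[OF assms] by (simp add: step_det_def)
qed

lemma det_step_coeff_monic:
  assumes "\<And>i. i < n \<Longrightarrow> degree (q i) = i" "\<And>i. i < n \<Longrightarrow> coeff (q i) i = 1"
  shows "det (mat n n (\<lambda>(i, j). step_coeff j (q i))) = step_det n"
proof -
  have "(\<Prod>i<n. coeff (q i) i) = 1"
    using assms by (intro prod.neutral) auto
  then show ?thesis using det_step_coeff[of n q] assms(1) by simp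
qed

lemma step_coeff_dickson_poly:
  "step_coeff j (dickson_poly i) = 4 ^ i * poly_binomial (indet + of_nat i + of_nat (2 * j + 3)) (2 * j + 3)
    + poly_binomial (indet - of_nat i + of_nat (2 * j + 3)) (2 * j + 3)"
proof -
  have "4 * fps_geom * (1 - fps_X) = (4 :: rat poly fps)"
    by (subst mult.assoc, subst mult.commute[of fps_geom], subst fps_geom_mult) simp
  then have "fps_eval (dickson_poly i) step_fps = (4 * fps_geom) ^ i + (1 - fps_X :: rat poly fps) ^ i"
    unfolding step_fps_def by (rule fps_eval_dickson_poly)
  then have "binom_fps indet * fps_eval (dickson_poly i) step_fps =
      fps_const (4 ^ i) * (fps_geom ^ i * binom_fps indet) + (1 - fps_X) ^ i * binom_fps indet"
    by (simp add: algebra_simps power_mult_distrib numeral_fps_const fps_const_power)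
  then show ?thesis
    by (simp add: step_coeff_def binom_fps_mult_power binom_fps_mult_geom_power binom_fps_nth)
qed

text \<open>The factor 2 comes from row 0, where \<open>dickson_poly\<close> is the constant 2; the
  other rows are monic.\<close>

lemma det_eq_step_det:
  assumes "n > 0"
  shows "det (mat n n (\<lambda>(i, j).
        4 ^ i * poly_binomial (indet + of_nat i + of_nat (2 * j + 3)) (2 * j + 3)
        + poly_binomial (indet - of_nat i + of_nat (2 * j + 3)) (2 * j + 3))) = 2 * step_det n"
proof -
  have "(\<Prod>i<n. coeff (dickson_poly i :: rat poly poly) i) = 2"
    using assms unfolding coeff_dickson_poly by (subst prod.delta) auto
  then show ?thesis
    using det_step_coeff[of n dickson_poly, OF degree_dickson_poly]
    unfolding step_coeff_dickson_poly by simp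
qed

text \<open>Only the rows in \<open>S\<close> are exchanged for the special \<open>q d\<close>; the
  others keep the plain power, so every row stays monic of the right degree.\<close>

lemma power_card_dvd_step_det:
  assumes S: "S \<subseteq> {..<n}"
    and q: "\<And>d. d \<in> S \<Longrightarrow> degree (q d) = d" "\<And>d. d \<in> S \<Longrightarrow> coeff (q d) d = 1"
    and dvd: "\<And>d j. d \<in> S \<Longrightarrow> p dvd step_coeff j (q d)"
  shows "p ^ card S dvd step_det n"
proof -
  define r where "r d = (if d \<in> S then q d else monom 1 d)" for d
  have "det (mat n n (\<lambda>(i, j). step_coeff j (r i))) = step_det n"
    by (rule det_step_coeff_monic) (auto simp: r_def q degree_monom_eq)
  moreover have "p ^ card S dvd det (mat n n (\<lambda>(i, j). step_coeff j (r i)))"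
    by (rule power_card_dvd_det) (use S dvd in \<open>auto simp: r_def\<close>)
  ultimately show ?thesis by simp
qed

section \<open>Roots of the determinant\<close>

text \<open>Modulo x + k, the indeterminate may be replaced by -k in each coefficient of the
  binomial series.\<close>

lemma binom_fps_cong_dvd:
  "[:of_nat k, 1:] dvd fps_nth (binom_fps indet * g) m - fps_nth (binom_fps (- of_nat k) * g) m"
proof -
  have "[:of_nat k, 1:] dvd (fps_nth (binom_fps indet) i - fps_nth (binom_fps (- of_nat k)) i)" for i
    using poly_eq_0_iff_dvd[of "fps_nth (binom_fps indet) i - fps_nth (binom_fps (- of_nat k)) i" "- of_nat k"]
    by (simp add: binom_fps_nth poly_poly_binomial)
  then show ?thesis
    unfolding fps_mult_nth sum_subtractf[symmetric] left_diff_distrib[symmetric]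
    by (intro dvd_sum dvd_mult2) auto
qed

text \<open>At x = -(K+1) the binomial series is \<open>(1 - fps_X) ^ K\<close>, whence the shift
  from \<open>K\<close> to \<open>Suc K\<close>.\<close>

lemma dvd_step_coeff_kernel:
  assumes "fps_nth ((1 - fps_X) ^ K * fps_eval q step_fps) (2 * j + 3) = 0"
  shows "[:of_nat (Suc K), 1:] dvd step_coeff j q"
  using binom_fps_cong_dvd[of "Suc K" "fps_eval q step_fps" "2 * j + 3"] assms
  unfolding binom_fps_neg step_coeff_def by simp

text \<open>The Pochhammer symbol with index b has the factors x + 3b + 1, ..., x + 2b + n, so the
  set counts the symbols containing x + K + 1. For each such b the row of degree K - 2b can be made
  divisible: \<open>3 * b \<le> K\<close> makes K - 3b a true exponent, and
  \<open>K < 2 * b + n\<close> says that this row exists.\<close>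

lemma linear_power_dvd_step_det:
  "[:of_nat (Suc K), 1:] ^ (card {b. b < n \<and> 3 * b \<le> K \<and> K < 2 * b + n} +
     (if n > 0 \<and> (K = 1 \<or> K = 2) then 1 else 0)) dvd step_det n"
proof -
  define B where "B = {b. b < n \<and> 3 * b \<le> K \<and> K < 2 * b + n}"
  define Z where "Z = (if n > 0 \<and> (K = 1 \<or> K = 2) then {0::nat} else {})"
  define q :: "nat \<Rightarrow> rat poly poly" where "q d = (if d \<in> Z then 1 else
    let b = (K - d) div 2 in [:-4, 1:] ^ b * [:-2, 1:] ^ (K - 3 * b))" for d
  have fin: "finite B" unfolding B_def by (rule finite_subset[of _ "{..<n}"]) auto
  \<comment> \<open>\<open>Z\<close> is nonempty only for K = 1 or 2. Then 3b \<le> K forces b = 0,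
    so the image contains at most K, and row 0 is an additional one.\<close>
  have disj: "(\<lambda>b. K - 2 * b) ` B \<inter> Z = {}"
    by (auto simp: B_def Z_def)
  have qB: "q (K - 2 * b) = [:-4, 1:] ^ b * [:-2, 1:] ^ (K - 3 * b)" if "b \<in> B" for b
  proof -
    have "(K - (K - 2 * b)) div 2 = b" using that by (auto simp: B_def)
    then show ?thesis using that disj by (auto simp: q_def Let_def)
  qed
  have inj: "inj_on (\<lambda>b. K - 2 * b) B"
    by (rule inj_onI) (auto simp: B_def)
  have "[:of_nat (Suc K), 1:] ^ card ((\<lambda>b. K - 2 * b) ` B \<union> Z) dvd step_det n"
  proof (rule power_card_dvd_step_det[where q = q])
    show "(\<lambda>b. K - 2 * b) ` B \<union> Z \<subseteq> {..<n}" by (auto simp: B_def Z_def)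
  next
    fix d assume d: "d \<in> (\<lambda>b. K - 2 * b) ` B \<union> Z"
    show deg: "degree (q d) = d"
    proof (cases "d \<in> Z")
      case True then show ?thesis by (auto simp: q_def Z_def split: if_splits)
    next
      case False
      then obtain b where b: "b \<in> B" "d = K - 2 * b" using d by auto
      then show ?thesis by (auto simp: qB B_def degree_mult_eq degree_power_eq)
    qed
    have "lead_coeff (q d) = 1"
      by (simp add: q_def Let_def lead_coeff_mult lead_coeff_power)
    then show "coeff (q d) d = 1" by (simp only: deg)
    fix j
    show "[:of_nat (Suc K), 1:] dvd step_coeff j (q d)"
    proof (rule dvd_step_coeff_kernel, cases "d \<in> Z")
      case True
      then have "K = 1 \<or> K = 2" "fps_eval (q d) step_fps = 1"
        by (auto simp: q_def Z_def fps_eval_def split: if_splits)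
      \<comment> \<open>The index is at least 3, beyond the degree K \<le> 2 in z.\<close>
      then show "fps_nth ((1 - fps_X) ^ K * fps_eval (q d) step_fps) (2 * j + 3) = 0"
        by (auto simp: power2_eq_square algebra_simps numeral_3_eq_3 fps_numeral_nth)
    next
      case False
      then obtain b where b: "b \<in> B" "d = K - 2 * b" using d by auto
      then have "fps_eval (q d) step_fps = (step_fps - 4) ^ b * (step_fps - 2) ^ (K - 3 * b)"
        by (simp add: qB fps_eval_mult fps_eval_power fps_eval_pCons fps_eval_0 numeral_fps_const
            flip: fps_const_neg)
      then show "fps_nth ((1 - fps_X) ^ K * fps_eval (q d) step_fps) (2 * j + 3) = 0"
        using even_kernel[of "2 * j + 3" b "K - 3 * b"] b by (simp add: B_def)
    qed
  qed
  also have "card ((\<lambda>b. K - 2 * b) ` B \<union> Z) = card B + card Z"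
    using fin disj inj by (subst card_Un_disjoint) (auto simp: card_image Z_def)
  also have "card Z = (if n > 0 \<and> (K = 1 \<or> K = 2) then 1 else 0)"
    by (simp add: Z_def)
  finally show ?thesis unfolding B_def .
qed

section \<open>Degree and leading coefficient of the determinant\<close>

lemma
  shows degree_poly_binomial_le: "degree (poly_binomial (indet + of_nat c) p) \<le> p"
    and coeff_poly_binomial: "coeff (poly_binomial (indet + of_nat c) p) p = 1 / fact p"
proof -
  have linear: "indet + of_nat c - of_nat k = [:of_nat c - of_nat k, 1:]" for k
    by (simp add: of_nat_poly)
  have bound: "degree (indet + of_nat c - of_nat k) \<le> 1" for k
    by (simp add: linear)
  show "degree (poly_binomial (indet + of_nat c) p) \<le> p"
    unfolding poly_binomial_def
    using degree_prod_bound[of "{..<p}" "\<lambda>k. indet + of_nat c - of_nat k" "\<lambda>_. 1"] bound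
    by (intro order.trans[OF degree_smult_le]) simp
  show "coeff (poly_binomial (indet + of_nat c) p) p = 1 / fact p"
    unfolding poly_binomial_def
    using coeff_prod_bound[of "{..<p}" "\<lambda>k. indet + of_nat c - of_nat k" "\<lambda>_. 1"] bound
    by (simp add: linear)
qed

text \<open>Multiplication by \<open>fps_X\<close> raises the index but not the degree, so it
  affects only lower terms; the constant 3 alone acts on the top coefficients.\<close>

lemma three_plus_X_power_mult:
  fixes f :: "rat poly fps"
  assumes "\<And>m. degree (fps_nth f m) \<le> m"
  shows "degree (fps_nth ((3 + fps_X) ^ i * f) m) \<le> m \<and>
    coeff (fps_nth ((3 + fps_X) ^ i * f) m) m = 3 ^ i * coeff (fps_nth f m) m"
proof (induction i arbitrary: m)
  case 0 then show ?case by (simp add: assms)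
next
  case (Suc i)
  define g where "g = (3 + fps_X) ^ i * f"
  have g: "degree (fps_nth g m) \<le> m" "coeff (fps_nth g m) m = 3 ^ i * coeff (fps_nth f m) m" for m
    using Suc by (auto simp: g_def)
  have step: "(3 + fps_X) ^ Suc i * f = fps_const 3 * g + fps_X * g"
    by (simp add: g_def algebra_simps numeral_fps_const)
  have three: "3 * p = smult 3 p" for p :: "rat poly"
    by (simp add: numeral_poly)
  show ?case
  proof (cases m)
    case 0 then show ?thesis using g[of 0] unfolding step by (simp add: three)
  next
    case (Suc l)
    have "coeff (fps_nth g l) m = 0"
      using g(1)[of l] Suc by (auto intro!: coeff_eq_0)
    then show ?thesis
      using g[of m] g(1)[of l] Suc unfolding step
      by (auto simp: three intro!: degree_add_le order.trans[OF degree_smult_le])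
  qed
qed

text \<open>
  The factor \<open>indet ^ i\<close> makes the degree bound depend on the column only, without truncated
  subtraction in \<open>2 * j + 3 - i\<close>.
\<close>

lemma step_coeff_minus_5:
  fixes i j :: nat
  defines "m \<equiv> 2 * j + 3"
  shows "degree (indet ^ i * step_coeff j ([:-5, 1:] ^ i)) \<le> m"
    and "coeff (indet ^ i * step_coeff j ([:-5, 1:] ^ i)) m =
      (if i \<le> m then 3 ^ i / fact (m - i) else 0)"
proof -
  \<comment> \<open>The factor \<open>fps_geom ^ i\<close> of (s-5)^i turns x into x + i.\<close>
  define f where "f = binom_fps (indet + of_nat i)"
  have f: "degree (fps_nth f l) \<le> l" "coeff (fps_nth f l) l = 1 / fact l" for l
    using degree_poly_binomial_le[of "i + l" l] coeff_poly_binomial[of "i + l" l]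
    by (simp_all add: f_def binom_fps_nth add.assoc)
  have "fps_eval ([:-5, 1:] ^ i) step_fps = (step_fps - 5 :: rat poly fps) ^ i"
    by (simp add: fps_eval_power fps_eval_pCons fps_eval_0 numeral_fps_const flip: fps_const_neg)
  then have "binom_fps indet * fps_eval ([:-5, 1:] ^ i) step_fps =
      binom_fps indet * (fps_X * (3 + fps_X) * fps_geom) ^ i"
    by (simp only: step_fps_minus_5)
  also have "\<dots> = fps_X ^ i * ((3 + fps_X) ^ i * (fps_geom ^ i * binom_fps indet))"
    by (simp only: power_mult_distrib mult_ac)
  finally have "binom_fps indet * fps_eval ([:-5, 1:] ^ i) step_fps = fps_X ^ i * ((3 + fps_X) ^ i * f)"
    by (simp only: binom_fps_mult_geom_power f_def)
  then have sc: "step_coeff j ([:-5, 1:] ^ i) =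
      (if m < i then 0 else fps_nth ((3 + fps_X) ^ i * f) (m - i))"
    by (simp add: step_coeff_def m_def fps_X_power_mult_nth)
  have indet: "indet ^ i = monom 1 i"
    by (simp add: monom_altdef)
  show "degree (indet ^ i * step_coeff j ([:-5, 1:] ^ i)) \<le> m"
    using three_plus_X_power_mult[OF f(1), of i "m - i"]
    by (auto simp: sc indet degree_monom_eq intro: order.trans[OF degree_mult_le])
  show "coeff (indet ^ i * step_coeff j ([:-5, 1:] ^ i)) m =
      (if i \<le> m then 3 ^ i / fact (m - i) else 0)"
    using three_plus_X_power_mult[OF f(1), of i "m - i"]
    by (auto simp: sc indet coeff_monom_mult f(2))
qed

text \<open>For \<open>i > m\<close> the factor with \<open>l = m\<close> vanishes, so the falling
  factorial covers both cases of the matrix of leading coefficients.\<close>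

lemma prod_diff_eq_fact_quotient:
  "(\<Prod>l<i. of_nat m - of_nat l :: 'a::field_char_0) = (if i \<le> m then fact m / fact (m - i) else 0)"
proof (induction i)
  case (Suc i)
  show ?case
  proof (cases "Suc i \<le> m")
    case True
    then have "m - i = Suc (m - Suc i)" by simp
    then have "(fact (m - i) :: 'a) = of_nat (m - i) * fact (m - Suc i)" by (metis fact_Suc)
    then show ?thesis using Suc True by (simp add: of_nat_diff)
  qed (use Suc in \<open>auto simp: not_less_eq_eq\<close>)
qed simp

lemma det_poly_basis:
  fixes q :: "nat \<Rightarrow> 'a::comm_ring_1 poly"
  assumes "\<And>i. i < n \<Longrightarrow> degree (q i) \<le> i"
  shows "det (mat n n (\<lambda>(i, j). poly (q i) (y j) * w j)) =
    (\<Prod>i<n. coeff (q i) i) * det (mat n n (\<lambda>(i, j). y j ^ i * w j))"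
proof -
  have "poly (q i) (y j) * w j = (\<Sum>e<n. coeff (q i) e * (y j ^ e * w j))" if "i < n" for i j
  proof -
    have "poly (q i) (y j) = (\<Sum>e<n. coeff (q i) e * y j ^ e)"
      unfolding poly_altdef using assms[OF that] that
      by (intro sum.mono_neutral_left) (auto simp: coeff_eq_0)
    then show ?thesis by (simp add: sum_distrib_right mult.assoc)
  qed
  then have "mat n n (\<lambda>(i, j). poly (q i) (y j) * w j) =
      mat n n (\<lambda>(i, j). \<Sum>e<n. coeff (q i) e * (y j ^ e * w j))"
    by (intro cong_mat) auto
  then show ?thesis
    using det_triangular_basis[of n q, OF assms] by simp
qed

text \<open>With y = 2j + 3 the entry is 3^i y(y-1)...(y-i+1) / y!, a polynomial of degree i in the
  node y times a weight of the column. As for a Vandermonde determinant, the polynomials matter only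
  through their leading coefficients.\<close>

lemma det_leading_coeffs:
  "det (mat n n (\<lambda>(i, j). if i \<le> 2 * j + 3 then 3 ^ i / fact (2 * j + 3 - i) else (0 :: rat))) =
    6 ^ (n choose 2) * (\<Prod>i<n. fact i / fact (2 * i + 3))"
proof -
  let ?y = "\<lambda>j. of_nat (2 * j + 3) :: rat" and ?w = "\<lambda>j. 1 / fact (2 * j + 3) :: rat"
  define q where "q i = smult (3 ^ i) (\<Prod>l<i. [:- of_nat l, 1:] :: rat poly)" for i
  \<comment> \<open>The Newton basis at the nodes \<open>2 * l + 3\<close>: it makes the matrix triangular.\<close>
  define r where "r i = (\<Prod>l<i. [:- of_nat (2 * l + 3), 1:] :: rat poly)" for i
  have deg: "degree (\<Prod>l<i. [:c l, 1:]) = i" "coeff (\<Prod>l<i. [:c l, 1:]) i = 1" for c :: "nat \<Rightarrow> rat" and i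
  proof -
    show "degree (\<Prod>l<i. [:c l, 1:]) = i"
      by (subst degree_prod_eq_sum_degree) auto
    then show "coeff (\<Prod>l<i. [:c l, 1:]) i = 1"
      using lead_coeff_prod[of "\<lambda>l. [:c l, 1:]" "{..<i}"] by simp
  qed
  have "mat n n (\<lambda>(i, j). if i \<le> 2 * j + 3 then 3 ^ i / fact (2 * j + 3 - i) else (0 :: rat)) =
      mat n n (\<lambda>(i, j). poly (q i) (?y j) * ?w j)"
    by (rule cong_mat) (auto simp: q_def poly_prod prod_diff_eq_fact_quotient[of "2 * _ + 3", simplified])
  also have "det \<dots> = (\<Prod>i<n. 3 ^ i) * det (mat n n (\<lambda>(i, j). ?y j ^ i * ?w j))"
    by (subst det_poly_basis) (auto simp: q_def deg intro!: order.trans[OF degree_smult_le])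
  also have "det (mat n n (\<lambda>(i, j). ?y j ^ i * ?w j)) = det (mat n n (\<lambda>(i, j). poly (r i) (?y j) * ?w j))"
    by (subst det_poly_basis) (auto simp: r_def deg)
  also have "\<dots> = (\<Prod>i<n. poly (r i) (?y i) * ?w i)"
  proof (subst det_upper_triangular)
    \<comment> \<open>For j < i the factor of \<open>r i\<close> with l = j vanishes at the node 2j
      + 3.\<close>
    show "upper_triangular (mat n n (\<lambda>(i, j). poly (r i) (?y j) * ?w j))"
      by (auto simp: r_def poly_prod upper_triangular_def)
  qed (auto simp: prod_list_diag_prod lessThan_atLeast0)
  also have "\<dots> = (\<Prod>i<n. 2 ^ i * (fact i / fact (2 * i + 3)))"
  proof (rule prod.cong)
    fix i
    have "poly (r i) (?y i) = (\<Prod>l<i. 2 * (of_nat i - of_nat l))"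
      by (simp add: r_def poly_prod algebra_simps)
    also have "\<dots> = 2 ^ i * fact i"
      unfolding prod.distrib prod_diff_eq_fact_quotient by simp
    finally show "poly (r i) (?y i) * ?w i = 2 ^ i * (fact i / fact (2 * i + 3))" by simp
  qed simp
  also have "(\<Prod>i<n. 3 ^ i) * (\<Prod>i<n. 2 ^ i * (fact i / fact (2 * i + 3))) =
      (\<Prod>i<n. 6 ^ i) * (\<Prod>i<n. fact i / fact (2 * i + 3) :: rat)"
    by (simp only: prod.distrib mult.assoc[symmetric]) (simp add: prod.distrib[symmetric] power_mult_distrib[symmetric])
  also have "(\<Prod>i<n. 6 ^ i :: rat) = 6 ^ (n choose 2)"
  proof -
    have "\<Sum>{..<n} = n choose 2"
      by (cases n) (simp_all add: lessThan_Suc_atMost atMost_atLeast0 gauss_sum_nat choose_two mult.commute)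
    then show ?thesis by (simp add: power_sum[symmetric])
  qed
  finally show ?thesis .
qed

text \<open>The powers of x put into the rows multiply the determinant by x^S with S = 0 + ... +
  (n-1). The sum of the column bounds 2j + 3 is attained because the coefficient there is nonzero;
  removing S leaves the sum of the j + 3.\<close>

lemma
  shows degree_step_det: "degree (step_det n) = (\<Sum>i<n. i + 3)"
    and lead_coeff_step_det: "lead_coeff (step_det n) = 6 ^ (n choose 2) * (\<Prod>i<n. fact i / fact (2 * i + 3))"
      (is "_ = ?c")
proof -
  let ?v = "\<lambda>i j. indet ^ i * step_coeff j ([:-5, 1:] ^ i)" and ?w = "\<lambda>j :: nat. 2 * j + 3"
  define S where "S = \<Sum>{..<n}"
  have "det (mat n n (\<lambda>(i, j). ?v i j)) = indet ^ S * det (mat n n (\<lambda>(i, j). step_coeff j ([:-5, 1:] ^ i)))"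
    by (subst det_row_factors) (simp add: S_def power_sum)
  also have "det (mat n n (\<lambda>(i, j). step_coeff j ([:-5, 1:] ^ i))) = step_det n"
    by (rule det_step_coeff_monic) (simp_all add: degree_power_eq coeff_linear_power)
  finally have det: "det (mat n n (\<lambda>(i, j). ?v i j)) = indet ^ S * step_det n" .
  have le: "degree (indet ^ S * step_det n) \<le> sum ?w {..<n}"
    unfolding det[symmetric] by (rule degree_det_bound) (rule step_coeff_minus_5)
  have co: "coeff (indet ^ S * step_det n) (sum ?w {..<n}) = ?c"
    unfolding det[symmetric]
    by (subst coeff_det_bound) (simp_all add: step_coeff_minus_5 det_leading_coeffs)
  have "?c \<noteq> 0" by simp
  then have deg: "degree (indet ^ S * step_det n) = sum ?w {..<n}"
    using le co by (metis le_antisym le_degree)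
  then have "step_det n \<noteq> 0" using co \<open>?c \<noteq> 0\<close> by auto
  then have "S + degree (step_det n) = sum ?w {..<n}"
    using deg by (simp add: degree_mult_eq degree_power_eq)
  moreover have "sum ?w {..<n} = S + (\<Sum>i<n. i + 3)"
    by (simp add: S_def sum.distrib[symmetric])
  ultimately show "degree (step_det n) = (\<Sum>i<n. i + 3)" by simp
  show "lead_coeff (step_det n) = ?c"
    using co unfolding deg[symmetric] by (simp add: lead_coeff_mult lead_coeff_power)
qed

section \<open>Collecting the linear factors\<close>

lemma coprime_linear:
  assumes "a \<noteq> b"
  shows "coprime [:a, 1:] [:b, 1 :: rat:]"
proof (rule coprimeI)
  fix p assume "p dvd [:a, 1:]" "p dvd [:b, 1:]"
  then have "p dvd [:a, 1:] - [:b, 1:]" by (rule dvd_diff)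
  moreover have "[:a, 1:] - [:b, 1:] dvd 1"
    using assms by (simp add: is_unit_const_poly_iff)
  ultimately show "is_unit p" by (rule dvd_trans)
qed

text \<open>Powers of distinct monic linear polynomials are pairwise coprime.\<close>

lemma prod_linear_power_dvd:
  fixes c :: "'i \<Rightarrow> rat"
  assumes "finite A" "inj_on c A" "\<And>k. k \<in> A \<Longrightarrow> [:c k, 1:] ^ m k dvd p"
  shows "(\<Prod>k\<in>A. [:c k, 1:] ^ m k) dvd p"
  using assms
proof (induction A rule: finite_induct)
  case (insert k A)
  have "coprime ([:c k, 1:] ^ m k) (\<Prod>k\<in>A. [:c k, 1:] ^ m k)"
  proof (rule prod_coprime_right)
    fix l assume "l \<in> A"
    then have "c k \<noteq> c l"
      using insert.hyps insert.prems(1) by (auto simp: inj_on_def)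
    then show "coprime ([:c k, 1:] ^ m k) ([:c l, 1:] ^ m l)"
      by (simp add: coprime_linear)
  qed
  then show ?case
    using insert by (simp add: divides_mult)
qed simp

definition linear_product :: "nat \<Rightarrow> rat poly"
  where "linear_product n = (indet + 2) * (indet + 3)
          * (\<Prod>i<n. pochhammer (indet + of_nat (3 * i + 1)) (n - i))"

lemma pochhammer_indet:
  "pochhammer (indet + of_nat c) m = (\<Prod>k\<in>{c..<c + m}. [:of_nat k, 1:])"
  unfolding pochhammer_prod
  by (rule prod.reindex_bij_witness[of _ "\<lambda>k. k - c" "\<lambda>l. c + l"]) (auto simp: of_nat_poly)

lemma degree_linear_product: "degree (linear_product n) = 2 + (\<Sum>i<n. i + 1)"
  and lead_coeff_linear_product: "lead_coeff (linear_product n) = 1"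
proof -
  have poch: "lead_coeff (pochhammer (indet + of_nat c) m) = 1" "degree (pochhammer (indet + of_nat c) m) = m" for c m
    unfolding pochhammer_indet lead_coeff_prod by (simp_all add: degree_prod_eq_sum_degree)
  have nz: "pochhammer (indet + of_nat c) m \<noteq> 0" for c m
    using poch(1)[of c m] by force
  have two: "indet + 2 = [:2, 1:]" "indet + 3 = [:3, 1:]"
    by (simp_all add: numeral_poly)
  have "(\<Sum>i<n. n - i) = (\<Sum>i<n. i + 1)"
    by (subst sum.nat_diff_reindex[symmetric]) (auto intro: sum.cong)
  then have prod: "degree (\<Prod>i<n. pochhammer (indet + of_nat (3 * i + 1)) (n - i)) = (\<Sum>i<n. i + 1)"
    by (subst degree_prod_eq_sum_degree) (simp_all only: poch nz, simp)
  have "(\<Prod>i<n. pochhammer (indet + of_nat (3 * i + 1)) (n - i)) \<noteq> 0"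
    by (simp only: prod_zero_iff finite_lessThan nz) simp
  then show "degree (linear_product n) = 2 + (\<Sum>i<n. i + 1)"
    unfolding linear_product_def two by (subst degree_mult_eq) (simp_all only: prod, simp_all)
  show "lead_coeff (linear_product n) = 1"
    unfolding linear_product_def two lead_coeff_mult lead_coeff_prod poch(1) by simp
qed

text \<open>Exchanging the products over the symbols and over the roots collects the exponent of
  each x + k, which is the multiplicity found for K = k - 1.\<close>

lemma linear_product_dvd_step_det:
  assumes "n > 0"
  shows "linear_product n dvd step_det n"
proof -
  \<comment> \<open>The symbols reach up to k = 3n - 2, and 2 and 3 must be included for every n >
    0. Starting at 1 makes \<open>k - 1\<close> exact.\<close>
  define A where "A = {1..3 * n + 3}"
  define L where "L k = [:of_nat k :: rat, 1:]" for k :: nat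
  define m where "m k = card {i. i < n \<and> 3 * i \<le> k - 1 \<and> k - 1 < 2 * i + n} +
     (if n > 0 \<and> (k - 1 = 1 \<or> k - 1 = 2) then 1 else 0)" for k
  have "(\<Prod>i<n. pochhammer (indet + of_nat (3 * i + 1)) (n - i)) =
      (\<Prod>i<n. \<Prod>k\<in>A. if 3 * i \<le> k - 1 \<and> k - 1 < 2 * i + n then L k else 1)"
  proof (rule prod.cong[OF refl])
    fix i assume "i \<in> {..<n}"
    then have "{3 * i + 1..<3 * i + 1 + (n - i)} = {k \<in> A. 3 * i \<le> k - 1 \<and> k - 1 < 2 * i + n}"
      by (auto simp: A_def)
    moreover have "finite A" by (simp add: A_def)
    ultimately show "pochhammer (indet + of_nat (3 * i + 1)) (n - i) =
        (\<Prod>k\<in>A. if 3 * i \<le> k - 1 \<and> k - 1 < 2 * i + n then L k else 1)"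
      by (simp only: pochhammer_indet L_def prod.inter_filter)
  qed
  also have "\<dots> = (\<Prod>k\<in>A. \<Prod>i<n. if 3 * i \<le> k - 1 \<and> k - 1 < 2 * i + n then L k else 1)"
    by (rule prod.swap)
  also have "\<dots> = (\<Prod>k\<in>A. L k ^ card {i. i < n \<and> 3 * i \<le> k - 1 \<and> k - 1 < 2 * i + n})"
    by (intro prod.cong refl, subst prod.inter_filter[symmetric]) (auto intro!: arg_cong[of _ _ "\<lambda>S. _ ^ card S"])
  finally have poch: "(\<Prod>i<n. pochhammer (indet + of_nat (3 * i + 1)) (n - i)) = \<dots>" .
  have "(indet + 2) * (indet + 3) = (\<Prod>k\<in>{2, 3}. L k)"
    by (simp add: L_def numeral_poly)
  also have "\<dots> = (\<Prod>k\<in>A. if k = 2 \<or> k = 3 then L k else 1)"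
  proof -
    have "{2, 3} = {k \<in> A. k = 2 \<or> k = 3}" "finite A" by (auto simp: A_def)
    then show ?thesis by (simp only: prod.inter_filter)
  qed
  also have "\<dots> = (\<Prod>k\<in>A. L k ^ (if n > 0 \<and> (k - 1 = 1 \<or> k - 1 = 2) then 1 else 0))"
    using assms by (intro prod.cong) (auto simp: A_def)
  finally have "linear_product n = (\<Prod>k\<in>A. L k ^ m k)"
    unfolding linear_product_def poch by (simp only: prod.distrib[symmetric] power_add[symmetric] m_def add.commute)
  also have "\<dots> dvd step_det n"
    unfolding L_def
  proof (rule prod_linear_power_dvd)
    fix k assume "k \<in> A"
    then show "[:of_nat k, 1:] ^ m k dvd step_det n"
      using linear_power_dvd_step_det[of "k - 1" n] by (simp add: A_def m_def)
  qed (auto simp: A_def inj_on_def)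
  finally show ?thesis .
qed

theorem theorem16:
  fixes n :: nat
  assumes "n > 0"
  shows "\<exists>Pol :: rat poly. lead_coeff Pol = 1 \<and> degree Pol = 2 * n - 2 \<and>
    det (mat n n (\<lambda>(i, j).
        4 ^ i * poly_binomial (indet + of_nat i + of_nat (2 * j + 3)) (2 * j + 3)
        + poly_binomial (indet - of_nat i + of_nat (2 * j + 3)) (2 * j + 3))) =
      smult (2 * 6 ^ (n choose 2) * (\<Prod>i<n. fact i / fact (2 * i + 3)))
        ((indet + 2) * (indet + 3)
          * (\<Prod>i<n. pochhammer (indet + of_nat (3 * i + 1)) (n - i)))
      * Pol"
proof -
  define c :: rat where "c = 6 ^ (n choose 2) * (\<Prod>i<n. fact i / fact (2 * i + 3))"
  have c: "c \<noteq> 0" by (simp add: c_def)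
  obtain R where R: "step_det n = linear_product n * R"
    using linear_product_dvd_step_det[OF assms] by (elim dvdE)
  \<comment> \<open>As \<open>linear_product n\<close> is monic, the quotient inherits the leading
    coefficient \<open>c\<close>; division by \<open>c\<close> then gives the monic witness.\<close>
  have lcR: "lead_coeff R = c"
    using lead_coeff_step_det[of n] lead_coeff_linear_product[of n]
    by (simp add: R lead_coeff_mult c_def)
  then have "R \<noteq> 0" "linear_product n \<noteq> 0"
    using c lead_coeff_linear_product[of n] by auto
  then have "degree R + (2 + (\<Sum>i<n. i + 1)) = (\<Sum>i<n. i + 3)"
    using degree_step_det[of n] by (simp add: R degree_mult_eq degree_linear_product)
  also have "(\<Sum>i<n. i + 3) = (\<Sum>i<n. i + 1) + 2 * n"
    unfolding sum.distrib by simp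
  finally have degR: "degree R = 2 * n - 2" by simp
  show ?thesis
  proof (intro exI[of _ "smult (1 / c) R"] conjI)
    show "lead_coeff (smult (1 / c) R) = 1" using c lcR by simp
    show "degree (smult (1 / c) R) = 2 * n - 2" using c degR by simp
    have "2 * step_det n = smult (2 * c) (linear_product n) * smult (1 / c) R"
      using c by (simp add: R numeral_poly)
    then show "det (mat n n (\<lambda>(i, j).
        4 ^ i * poly_binomial (indet + of_nat i + of_nat (2 * j + 3)) (2 * j + 3)
        + poly_binomial (indet - of_nat i + of_nat (2 * j + 3)) (2 * j + 3))) =
      smult (2 * 6 ^ (n choose 2) * (\<Prod>i<n. fact i / fact (2 * i + 3)))
        ((indet + 2) * (indet + 3)
          * (\<Prod>i<n. pochhammer (indet + of_nat (3 * i + 1)) (n - i))) * smult (1 / c) R"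
      unfolding det_eq_step_det[OF assms] linear_product_def c_def by (simp only: mult.assoc)
  qed
qed
end
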